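(* Let $E$ be a graph and let $E_O$ be any multi-out-split of $E$. Then the multi-out-split homomorphism $f_O\colon E_O\to E$, $f_O(v^i)=v$, $f_O(e^i)=e$, is an admissible graph homomorphism.
   Context: A graph $E=(E^0,E^1,s_E,t_E)$ consists of arbitrary sets of vertices $E^0$ and edges $E^1$ with source and target maps $s_E,t_E\colon E^1\to E^0$. A vertex $v$ is a sink if $s_E^{-1}(v)=\emptyset$, and regular if $s_E^{-1}(v)$ is finite and nonempty; $\mathrm{reg}(E)$ is the set of regular vertices. A graph homomorphism is a pair of maps on vertices and on edges commuting with sources and targets. A graph homomorphism $f\colon E\to F$ is admissible if it is (1) proper: $f^{-1}(v)$ and $f^{-1}(e)$ are finite for all $v\in F^0$, $e\in F^1$; (2) target bijective: for every $x\in F^1$ the restricted target map $t_E\colon f^{-1}(x)\to f^{-1}(t_F(x))$ is bijective; (3) regular: $f^{-1}(\mathrm{reg}(F))\subseteq\mathrm{reg}(E)$. Multi-out-split: for every $v\in E^0$ emitting at least one edge, partition $s_E^{-1}(v)$ into a finite disjoint union of nonempty sets $\epsilon_v^1\cup\dots\cup\epsilon_v^{m(v)}$, $m(v)\ge1$, with at most one $\epsilon_v^i$ infinite; if $v$ is a sink set $m(v)=1$. The multi-out-split $E_O$ is the graph with $E_O^0=\{v^i\mid v\in E^0,1\le i\le m(v)\}$, $E_O^1=\{e^i\mid e\in E^1,1\le i\le m(t_E(e))\}$, $s_{E_O}(e^i)=s_E(e)^j$ for $e\in\epsilon^j_{s_E(e)}$, and $t_{E_O}(e^i)=t_E(e)^i$.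 *)

theory Defs
  imports "Graph_Theory.Digraph" "HOL-Library.Disjoint_Sets"
begin

text \<open>
  A graph is a \<^const>\<open>wf_digraph\<close>, with \<^const>\<open>tail\<close> as source map and \<^const>\<open>head\<close> as target map;
  loops, parallel edges and infinite sets of vertices and edges are allowed.
\<close>

definition is_sink :: "('a, 'b) pre_digraph \<Rightarrow> 'a \<Rightarrow> bool" where
  "is_sink E v \<longleftrightarrow> out_arcs E v = {}"

definition reg :: "('a, 'b) pre_digraph \<Rightarrow> 'a set" where
  "reg E = {v \<in> verts E. finite (out_arcs E v) \<and> out_arcs E v \<noteq> {}}"

text \<open>
  A homomorphism is a pair of HOL functions, relevant only on the vertices and edges of the domain
  graph; accordingly, all preimages are intersected with these sets.
\<close>

type_synonym ('a, 'b, 'c, 'd) graph_map = "('a \<Rightarrow> 'c) \<times> ('b \<Rightarrow> 'd)"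

definition vert_fibre :: "('a, 'b) pre_digraph \<Rightarrow> ('a, 'b, 'c, 'd) graph_map \<Rightarrow> 'c \<Rightarrow> 'a set" where
  "vert_fibre E f v = fst f -` {v} \<inter> verts E"

definition arc_fibre :: "('a, 'b) pre_digraph \<Rightarrow> ('a, 'b, 'c, 'd) graph_map \<Rightarrow> 'd \<Rightarrow> 'b set" where
  "arc_fibre E f x = snd f -` {x} \<inter> arcs E"

definition graph_hom ::
  "('a, 'b) pre_digraph \<Rightarrow> ('c, 'd) pre_digraph \<Rightarrow> ('a, 'b, 'c, 'd) graph_map \<Rightarrow> bool" where
  "graph_hom E F f \<longleftrightarrow>
     wf_digraph E \<and> wf_digraph F \<and>
     fst f ` verts E \<subseteq> verts F \<and> snd f ` arcs E \<subseteq> arcs F \<and>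
     (\<forall>e \<in> arcs E. tail F (snd f e) = fst f (tail E e) \<and> head F (snd f e) = fst f (head E e))"

definition proper_hom ::
  "('a, 'b) pre_digraph \<Rightarrow> ('c, 'd) pre_digraph \<Rightarrow> ('a, 'b, 'c, 'd) graph_map \<Rightarrow> bool" where
  "proper_hom E F f \<longleftrightarrow>
     (\<forall>v \<in> verts F. finite (vert_fibre E f v)) \<and> (\<forall>x \<in> arcs F. finite (arc_fibre E f x))"

definition target_bijective ::
  "('a, 'b) pre_digraph \<Rightarrow> ('c, 'd) pre_digraph \<Rightarrow> ('a, 'b, 'c, 'd) graph_map \<Rightarrow> bool" where
  "target_bijective E F f \<longleftrightarrow>
     (\<forall>x \<in> arcs F. bij_betw (head E) (arc_fibre E f x) (vert_fibre E f (head F x)))"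

definition regular_hom ::
  "('a, 'b) pre_digraph \<Rightarrow> ('c, 'd) pre_digraph \<Rightarrow> ('a, 'b, 'c, 'd) graph_map \<Rightarrow> bool" where
  "regular_hom E F f \<longleftrightarrow> fst f -` reg F \<inter> verts E \<subseteq> reg E"

definition admissible_hom ::
  "('a, 'b) pre_digraph \<Rightarrow> ('c, 'd) pre_digraph \<Rightarrow> ('a, 'b, 'c, 'd) graph_map \<Rightarrow> bool" where
  "admissible_hom E F f \<longleftrightarrow>
     graph_hom E F f \<and> proper_hom E F f \<and> target_bijective E F f \<and> regular_hom E F f"

text \<open>
  The data of a multi-out-split: \<open>m v\<close> is the number of classes at \<open>v\<close> and \<open>\<epsilon> v i\<close>, for
  \<open>1 \<le> i \<le> m v\<close>, is the \<open>i\<close>-th class. The values of \<open>\<epsilon>\<close> at sinks and at indices outside this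
  range are irrelevant.
\<close>

definition multi_out_split_data ::
  "('a, 'b) pre_digraph \<Rightarrow> ('a \<Rightarrow> nat) \<Rightarrow> ('a \<Rightarrow> nat \<Rightarrow> 'b set) \<Rightarrow> bool" where
  "multi_out_split_data E m \<epsilon> \<longleftrightarrow>
     (\<forall>v \<in> verts E.
        (is_sink E v \<longrightarrow> m v = 1) \<and>
        (\<not> is_sink E v \<longrightarrow>
           m v \<ge> 1 \<and>
           (\<Union>i \<in> {1..m v}. \<epsilon> v i) = out_arcs E v \<and>
           disjoint_family_on (\<epsilon> v) {1..m v} \<and>
           (\<forall>i \<in> {1..m v}. \<epsilon> v i \<noteq> {}) \<and>
           (\<forall>i \<in> {1..m v}. \<forall>j \<in> {1..m v}. infinite (\<epsilon> v i) \<and> infinite (\<epsilon> v j) \<longrightarrow> i = j)))"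

definition class_index ::
  "('a, 'b) pre_digraph \<Rightarrow> ('a \<Rightarrow> nat) \<Rightarrow> ('a \<Rightarrow> nat \<Rightarrow> 'b set) \<Rightarrow> 'b \<Rightarrow> nat" where
  "class_index E m \<epsilon> e = (THE j. j \<in> {1..m (tail E e)} \<and> e \<in> \<epsilon> (tail E e) j)"

text \<open>The vertex \<open>v\<^sup>i\<close> and the edge \<open>e\<^sup>i\<close> are the pairs \<open>(v, i)\<close> and \<open>(e, i)\<close>.\<close>

definition multi_out_split ::
  "('a, 'b) pre_digraph \<Rightarrow> ('a \<Rightarrow> nat) \<Rightarrow> ('a \<Rightarrow> nat \<Rightarrow> 'b set) \<Rightarrow> ('a \<times> nat, 'b \<times> nat) pre_digraph"
  where
  "multi_out_split E m \<epsilon> =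
     \<lparr> verts = (SIGMA v : verts E. {1..m v}),
       arcs = (SIGMA e : arcs E. {1..m (head E e)}),
       tail = (\<lambda>(e, i). (tail E e, class_index E m \<epsilon> e)),
       head = (\<lambda>(e, i). (head E e, i)) \<rparr>"

definition multi_out_split_hom :: "('a \<times> nat, 'b \<times> nat, 'a, 'b) graph_map" where
  "multi_out_split_hom = (\<lambda>(v, i). v, \<lambda>(e, i). e)"

end

theory Submission
  imports Defs
begin

text \<open>The fibre of \<open>f_O\<close> over \<open>v\<close> is
  \<open>{v} \<times> {1..m v}\<close>, and over an edge \<open>e\<close> it is
  \<open>{e} \<times> {1..m (head E e)}\<close>. Both are finite, which gives properness, and the
  target map sends \<open>(e, i)\<close> to \<open>(head E e, i)\<close>, so it matches the fibre
  over \<open>e\<close> with the fibre over its target index by index. Regularity rests on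
  \<open>out_arcs_multi_out_split\<close>: the copy \<open>(v, i)\<close> emits exactly the copies
  of the edges in the class \<open>\<epsilon> v i\<close>. If \<open>v\<close> is regular, this
  class is finite and nonempty, and each of its edges has finitely many copies and at least
  one.\<close>

lemma multi_out_split_simps:
  "verts (multi_out_split E m \<epsilon>) = (SIGMA v : verts E. {1..m v})"
  "arcs (multi_out_split E m \<epsilon>) = (SIGMA e : arcs E. {1..m (head E e)})"
  "tail (multi_out_split E m \<epsilon>) x = (tail E (fst x), class_index E m \<epsilon> (fst x))"
  "head (multi_out_split E m \<epsilon>) x = (head E (fst x), snd x)"
  by (simp_all add: multi_out_split_def split_beta)

lemma multi_out_split_hom_simps:
  "fst multi_out_split_hom = fst" "snd multi_out_split_hom = fst"
  by (auto simp: multi_out_split_hom_def)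

lemma vert_fibre_multi_out_split:
  assumes "v \<in> verts E"
  shows "vert_fibre (multi_out_split E m \<epsilon>) multi_out_split_hom v = {v} \<times> {1..m v}"
  using assms by (auto simp: vert_fibre_def multi_out_split_simps multi_out_split_hom_simps)

lemma arc_fibre_multi_out_split:
  assumes "e \<in> arcs E"
  shows "arc_fibre (multi_out_split E m \<epsilon>) multi_out_split_hom e = {e} \<times> {1..m (head E e)}"
  using assms by (auto simp: arc_fibre_def multi_out_split_simps multi_out_split_hom_simps)

locale multi_out_split_graph = wf_digraph E
  for E :: "('a, 'b) pre_digraph" +
  fixes m :: "'a \<Rightarrow> nat" and \<epsilon> :: "'a \<Rightarrow> nat \<Rightarrow> 'b set"
  assumes data: "multi_out_split_data E m \<epsilon>"
begin

text \<open>Covers sinks too, so every edge has at least one copy, whatever its target.\<close>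

lemma m_ge_1: "v \<in> verts E \<Longrightarrow> m v \<ge> 1"
  using data unfolding multi_out_split_data_def by (metis order_refl)

lemma
  assumes "v \<in> verts E" "\<not> is_sink E v"
  shows UN_classes: "(\<Union>i \<in> {1..m v}. \<epsilon> v i) = out_arcs E v"
    and disjoint_classes: "disjoint_family_on (\<epsilon> v) {1..m v}"
    and class_nonempty: "i \<in> {1..m v} \<Longrightarrow> \<epsilon> v i \<noteq> {}"
  using data assms unfolding multi_out_split_data_def by blast+

text \<open>Disjointness of the classes gives the uniqueness that the definite description in
  \<open>class_index\<close> requires.\<close>

lemma class_index_eq:
  assumes "v \<in> verts E" "\<not> is_sink E v" "i \<in> {1..m v}" "e \<in> \<epsilon> v i"
  shows "class_index E m \<epsilon> e = i"
proof -
  have "e \<in> out_arcs E v"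
    using UN_classes[OF assms(1,2)] assms(3,4) by blast
  then have "tail E e = v"
    by simp
  moreover have "j = i" if "j \<in> {1..m v}" "e \<in> \<epsilon> v j" for j
    using disjoint_family_onD[OF disjoint_classes[OF assms(1,2)] that(1) assms(3)] that(2) assms(4)
    by blast
  ultimately show ?thesis
    unfolding class_index_def using assms(3,4) by (intro the_equality) blast+
qed

text \<open>The classes cover all edges leaving the source, which gives existence; hence the source
  of each copy of \<open>e\<close> is a genuine vertex of the split.\<close>

lemma arc_in_class:
  assumes "e \<in> arcs E"
  shows "class_index E m \<epsilon> e \<in> {1..m (tail E e)}"
    and "e \<in> \<epsilon> (tail E e) (class_index E m \<epsilon> e)"
proof -
  have v: "tail E e \<in> verts E" "\<not> is_sink E (tail E e)"
    using assms by (auto simp: is_sink_def)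
  have "e \<in> out_arcs E (tail E e)"
    using assms by simp
  then obtain i where "i \<in> {1..m (tail E e)}" "e \<in> \<epsilon> (tail E e) i"
    using UN_classes[OF v] by blast
  with class_index_eq[OF v this]
  show "class_index E m \<epsilon> e \<in> {1..m (tail E e)}" "e \<in> \<epsilon> (tail E e) (class_index E m \<epsilon> e)"
    by simp_all
qed

lemma out_arcs_multi_out_split:
  assumes "v \<in> verts E" "\<not> is_sink E v" "i \<in> {1..m v}"
  shows "out_arcs (multi_out_split E m \<epsilon>) (v, i) = (SIGMA e : \<epsilon> v i. {1..m (head E e)})"
proof -
  \<comment> \<open>The classes at \<open>v\<close> are the level sets of \<open>class_index\<close>
    on the edges leaving \<open>v\<close>, and the source map of the split is defined through that
    index.\<close>
  have "e \<in> \<epsilon> v i \<longleftrightarrow> e \<in> arcs E \<and> tail E e = v \<and> class_index E m \<epsilon> e = i" for e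
  proof
    assume e: "e \<in> \<epsilon> v i"
    then have "e \<in> out_arcs E v"
      using UN_classes[OF assms(1,2)] assms(3) by blast
    with class_index_eq[OF assms e]
    show "e \<in> arcs E \<and> tail E e = v \<and> class_index E m \<epsilon> e = i"
      by simp
  qed (use arc_in_class(2) in blast)
  then show ?thesis
    by (simp add: set_eq_iff multi_out_split_simps conj_ac)
qed

lemma wf_multi_out_split: "wf_digraph (multi_out_split E m \<epsilon>)"
  using arc_in_class(1) by unfold_locales (auto simp: multi_out_split_simps)

lemma graph_hom_multi_out_split: "graph_hom (multi_out_split E m \<epsilon>) E multi_out_split_hom"
  using wf_multi_out_split wf_digraph_axioms
  by (auto simp: graph_hom_def multi_out_split_simps multi_out_split_hom_simps)

lemma proper_hom_multi_out_split: "proper_hom (multi_out_split E m \<epsilon>) E multi_out_split_hom"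
  by (simp add: proper_hom_def vert_fibre_multi_out_split arc_fibre_multi_out_split)

text \<open>On a fibre the edge is fixed and the target map keeps the index, which runs over
  \<open>{1..m (head E e)}\<close> on both sides.\<close>

lemma target_bijective_multi_out_split:
  "target_bijective (multi_out_split E m \<epsilon>) E multi_out_split_hom"
  by (auto simp: target_bijective_def vert_fibre_multi_out_split arc_fibre_multi_out_split
      bij_betw_def inj_on_def image_def multi_out_split_simps)

lemma regular_hom_multi_out_split: "regular_hom (multi_out_split E m \<epsilon>) E multi_out_split_hom"
  unfolding regular_hom_def
proof
  fix x assume x: "x \<in> fst multi_out_split_hom -` reg E \<inter> verts (multi_out_split E m \<epsilon>)"
  obtain v i where x_eq: "x = (v, i)"
    by (cases x)
  with x have v: "v \<in> verts E" "\<not> is_sink E v" and i: "i \<in> {1..m v}"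
    and fin: "finite (out_arcs E v)"
    by (auto simp: multi_out_split_hom_simps multi_out_split_simps reg_def is_sink_def)
  have sub: "\<epsilon> v i \<subseteq> out_arcs E v"
    using UN_classes[OF v] i by blast
  obtain e where e: "e \<in> \<epsilon> v i"
    using class_nonempty[OF v i] by blast
  with sub have "e \<in> arcs E"
    by auto
  then have "m (head E e) \<ge> 1"
    by (intro m_ge_1) simp
  \<comment> \<open>The first copy of \<open>e\<close> exists even when the target of
    \<open>e\<close> is a sink, so \<open>(v, i)\<close> emits an edge.\<close>
  with e have "(e, 1) \<in> (SIGMA e : \<epsilon> v i. {1..m (head E e)})"
    by simp
  moreover have "finite (SIGMA e : \<epsilon> v i. {1..m (head E e)})"
    using finite_subset[OF sub fin] by simp
  ultimately show "x \<in> reg (multi_out_split E m \<epsilon>)"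
    using x unfolding reg_def x_eq mem_Collect_eq out_arcs_multi_out_split[OF v i] by blast
qed

end

theorem proposition5p5:
  fixes E :: "('a, 'b) pre_digraph"
    and m :: "'a \<Rightarrow> nat"
    and \<epsilon> :: "'a \<Rightarrow> nat \<Rightarrow> 'b set"
  assumes "wf_digraph E"
    and "multi_out_split_data E m \<epsilon>"
  shows "admissible_hom (multi_out_split E m \<epsilon>) E multi_out_split_hom"
proof -
  interpret multi_out_split_graph E m \<epsilon>
    using assms by (simp add: multi_out_split_graph_def multi_out_split_graph_axioms_def)
  show ?thesis
    by (simp add: admissible_hom_def graph_hom_multi_out_split proper_hom_multi_out_split
        target_bijective_multi_out_split regular_hom_multi_out_split)
qed

end
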